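(* Let $p$ be a prime and consider the $p$-adic hard-core model with spin values in $\mathbb N_0=\{0,1,2,\dots\}$ on the Cayley tree of order $k\ge1$. There does not exist a $p$-adic Gibbs distribution on the set of admissible configurations; that is, there are no parameters $\lambda_i\in\mathcal E_p$ $(i\in\mathbb N_0)$ and boundary functions $\mathbf z_{i,x}\in\mathcal E_p$ $(i\in\mathbb N_0,\ x\in V)$ for which the finite-volume distributions $\mu^{(n)}$ on admissible configurations (see context) are consistent.
   Context: $\mathcal E_p=\{a\in\mathbb Q_p:|a-1|_p<p^{-1/(p-1)}\}$. The Cayley tree of order $k$ is the infinite tree with vertex set $V$ in which every vertex has exactly $k+1$ neighbours. Fix a root $x^0\in V$; $d$ is graph distance, $W_n=\{x\in V:d(x,x^0)=n\}$, $V_n=\bigcup_{m=0}^nW_m$; for $x\in W_n$, $S(x)=\{y\in W_{n+1}:d(x,y)=1\}$ is the set of direct successors. A configuration is a function $\sigma$ from vertices to $\mathbb N_0$; it is admissible if $\sigma(x)\sigma(y)=0$ for all neighbouring $x,y$. Given parameters $\lambda_i\in\mathbb Q_p$, a fixed $p$-adic probability measure $\nu=\{\nu(i)\in\mathbb Q_p\}_{i\in\mathbb N_0}$, and $\mathbf z:x\mapsto(\mathbf z_{i,x})_{i\in\mathbb N_0}\in\mathbb Q_p^{\mathbb N_0}$ on $V$, the generalized Gibbs distributions are $$\mu^{(n)}(\sigma_n)=\frac1{Z_n}\prod_{x\in V_n}\lambda_{\sigma_n(x)}\nu(\sigma_n(x))\prod_{x\in W_n}\mathbf z_{\sigma_n(x),x},$$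 where $\sigma_n$ is an admissible configuration on $V_n$ and $Z_n$ is the normalizing sum. Consistency (compatibility) of the family $(\mu^{(n)})_n$ on admissible configurations is taken in the form of the following equation, to which it is equivalent (with $\lambda_i$ redefined to absorb $\nu(i)$): for every $x\in V\setminus\{x^0\}$, $$\mathbf z_{i,x}=\lambda_i\prod_{y\in S(x)}\frac1{1+\sum_{j\in\mathbb N_0}\mathbf z_{j,y}},\qquad i\in\mathbb N_0,$$ where the series $\sum_j\lambda_j$ and $\sum_j\mathbf z_{j,y}$, $y\in V$, are required to converge in $\mathbb Q_p$ and $1+\sum_j\mathbf z_{j,y}\ne0$. A generalized Gibbs distribution is called a $p$-adic Gibbs distribution if $\lambda_i,\mathbf z_{i,x}\in\mathcal E_p$ for all $i\in\mathbb N_0$, $x\in V$. *)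

theory Defs
  imports "HOL-Analysis.Analysis" "Berlekamp_Zassenhaus.Finite_Field"
begin

section \<open>The field of \<open>p\<close>-adic numbers\<close>

text \<open>
  The field of \<open>p\<close>-adic numbers is the type \<open>'p padic\<close>, where the prime is \<open>p = CARD('p)\<close>
  with \<open>'p\<close> of class \<open>prime_card\<close>.  It is built as the completion of the rationals with respect
  to the \<open>p\<close>-adic absolute value.
\<close>

subsection \<open>The \<open>p\<close>-adic absolute value on the rationals\<close>

definition padic_val :: "nat \<Rightarrow> rat \<Rightarrow> int" where
  "padic_val p r = int (multiplicity (int p) (fst (quotient_of r)))
                 - int (multiplicity (int p) (snd (quotient_of r)))"

definition padic_abs :: "nat \<Rightarrow> rat \<Rightarrow> real" where
  "padic_abs p r = (if r = 0 then 0 else real p powi (- padic_val p r))"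

lemma padic_abs_frac:
  assumes p: "prime p" and ab: "a \<noteq> 0" "b \<noteq> 0"
  shows "padic_abs p (of_int a / of_int b) =
           real p powi (int (multiplicity (int p) b) - int (multiplicity (int p) a))"
proof -
  define r :: rat where "r = of_int a / of_int b"
  obtain c d where cd: "quotient_of r = (c, d)" by force
  have d: "d > 0" and r: "r = of_int c / of_int d"
    using quotient_of_denom_pos[OF cd] quotient_of_div[OF cd] by auto
  have r0: "r \<noteq> 0" using ab by (simp add: r_def)
  have c: "c \<noteq> 0" using r r0 by auto
  have "(of_int (a * d) :: rat) = of_int (c * b)"
    using r r_def ab d by (simp add: field_simps)
  then have eq: "a * d = c * b" by (simp only: of_int_eq_iff)
  have pe: "prime_elem (int p)" using p by simp
  have "multiplicity (int p) a + multiplicity (int p) d =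
        multiplicity (int p) c + multiplicity (int p) b"
    using prime_elem_multiplicity_mult_distrib[OF pe, of a d]
      prime_elem_multiplicity_mult_distrib[OF pe, of c b] eq ab c d by auto
  then show ?thesis
    using r0 cd unfolding r_def[symmetric] padic_abs_def padic_val_def
    by (auto intro!: arg_cong[where f = "power_int (real p)"])
qed

locale nonarch_abs =
  fixes N :: "rat \<Rightarrow> real"
  assumes N_0 [simp]: "N 0 = 0"
    and N_pos: "a \<noteq> 0 \<Longrightarrow> N a > 0"
    and N_mult: "N (a * b) = N a * N b"
    and N_ultra: "N (a + b) \<le> max (N a) (N b)"

lemma nonarch_abs_padic_abs:
  assumes p: "prime p"
  shows "nonarch_abs (padic_abs p)"
proof
  have p0: "real p > 1" using prime_gt_1_nat[OF p] by simp
  have pe: "prime_elem (int p)" using p by simp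
  have pu: "\<not> is_unit (int p)" using pe by (rule prime_elem_not_unit)
  show 0: "padic_abs p 0 = 0" by (simp add: padic_abs_def)
  show "padic_abs p a > 0" if "a \<noteq> 0" for a
    using p0 that by (simp add: padic_abs_def)
  show "padic_abs p (a * b) = padic_abs p a * padic_abs p b" for a b
  proof (cases "a = 0 \<or> b = 0")
    case True then show ?thesis using 0 by auto
  next
    case False
    obtain a1 a2 where a: "quotient_of a = (a1, a2)" by force
    obtain b1 b2 where b: "quotient_of b = (b1, b2)" by force
    have a': "a2 > 0" "a = of_int a1 / of_int a2"
      using quotient_of_denom_pos[OF a] quotient_of_div[OF a] by auto
    have b': "b2 > 0" "b = of_int b1 / of_int b2"
      using quotient_of_denom_pos[OF b] quotient_of_div[OF b] by auto
    have nz: "a1 \<noteq> 0" "b1 \<noteq> 0" "a2 \<noteq> 0" "b2 \<noteq> 0" using False a' b' by auto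
    have ab: "a * b = of_int (a1 * b1) / of_int (a2 * b2)" using a' b' by simp
    have A: "padic_abs p a = real p powi (int (multiplicity (int p) a2) - int (multiplicity (int p) a1))"
      using padic_abs_frac[OF p nz(1) nz(3)] a' by simp
    have B: "padic_abs p b = real p powi (int (multiplicity (int p) b2) - int (multiplicity (int p) b1))"
      using padic_abs_frac[OF p nz(2) nz(4)] b' by simp
    have "padic_abs p (a * b) = real p powi (int (multiplicity (int p) (a2 * b2)) - int (multiplicity (int p) (a1 * b1)))"
      unfolding ab by (rule padic_abs_frac[OF p]) (use nz in auto)
    also have "\<dots> = real p powi ((int (multiplicity (int p) a2) - int (multiplicity (int p) a1))
        + (int (multiplicity (int p) b2) - int (multiplicity (int p) b1)))"
      using nz by (simp add: prime_elem_multiplicity_mult_distrib[OF pe] algebra_simps)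
    also have "\<dots> = padic_abs p a * padic_abs p b"
      unfolding A B using p0 by (subst power_int_add) auto
    finally show ?thesis .
  qed
  show "padic_abs p (a + b) \<le> max (padic_abs p a) (padic_abs p b)" for a b
  proof (cases "a = 0 \<or> b = 0 \<or> a + b = 0")
    case True
    have nn: "padic_abs p x \<ge> 0" for x using p0 by (simp add: padic_abs_def)
    from True show ?thesis using 0 nn[of a] nn[of b] by auto
  next
    case False
    obtain a1 a2 where a: "quotient_of a = (a1, a2)" by force
    obtain b1 b2 where b: "quotient_of b = (b1, b2)" by force
    have a': "a2 > 0" "a = of_int a1 / of_int a2"
      using quotient_of_denom_pos[OF a] quotient_of_div[OF a] by auto
    have b': "b2 > 0" "b = of_int b1 / of_int b2"
      using quotient_of_denom_pos[OF b] quotient_of_div[OF b] by auto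
    define u v w where "u = a1 * b2" and "v = b1 * a2" and "w = a2 * b2"
    have w: "w \<noteq> 0" and au: "a = of_int u / of_int w" and bv: "b = of_int v / of_int w"
      using a' b' by (auto simp: u_def v_def w_def)
    have ab: "a + b = of_int (u + v) / of_int w" using w by (simp add: au bv add_divide_distrib)
    have nz: "u \<noteq> 0" "v \<noteq> 0" "u + v \<noteq> 0" using False w unfolding ab by (auto simp: au bv)
    let ?m = "multiplicity (int p)"
    have "min (?m u) (?m v) \<le> ?m (u + v)"
    proof (rule multiplicity_geI)
      show "int p ^ min (?m u) (?m v) dvd u + v"
        by (intro dvd_add multiplicity_dvd') auto
    qed (use nz pu in auto)
    then have "int (?m w) - int (?m (u + v)) \<le> max (int (?m w) - int (?m u)) (int (?m w) - int (?m v))"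
      by linarith
    then have "real p powi (int (?m w) - int (?m (u + v)))
        \<le> max (real p powi (int (?m w) - int (?m u))) (real p powi (int (?m w) - int (?m v)))"
      using p0 unfolding le_max_iff_disj by (meson less_imp_le power_int_increasing)
    then show ?thesis
      unfolding ab unfolding au bv using padic_abs_frac[OF p _ w] nz by (simp flip: of_int_add)
  qed
qed


subsection \<open>Cauchy sequences of rationals\<close>

context nonarch_abs
begin

definition null :: "(nat \<Rightarrow> rat) \<Rightarrow> bool" where
  "null X \<longleftrightarrow> (\<lambda>n. N (X n)) \<longlonglongrightarrow> 0"

definition cau :: "(nat \<Rightarrow> rat) \<Rightarrow> bool" where
  "cau X \<longleftrightarrow> (\<forall>e>0. \<exists>k. \<forall>m\<ge>k. \<forall>n\<ge>k. N (X m - X n) < e)"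

lemma N_ge_0 [simp]: "N a \<ge> 0"
  using N_pos[of a] by (cases "a = 0") auto

lemma N_eq_0_iff [simp]: "N a = 0 \<longleftrightarrow> a = 0"
  using N_pos[of a] by fastforce

lemma N_1 [simp]: "N 1 = 1"
proof -
  have "N 1 * N 1 = N 1 * 1" using N_mult[of 1 1] by simp
  then show ?thesis using N_pos[of 1] by simp
qed

lemma N_minus [simp]: "N (- a) = N a"
proof -
  have "N (- 1) * N (- 1) = 1" using N_mult[of "- 1" "- 1"] by simp
  then have "(N (- 1))\<^sup>2 = 1\<^sup>2" by (simp add: power2_eq_square)
  then have "N (- 1) = 1" by (rule power2_eq_imp_eq) auto
  then show ?thesis using N_mult[of "- 1" a] by simp
qed

lemma N_minus_commute: "N (a - b) = N (b - a)"
  using N_minus[of "a - b"] by simp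

lemma N_triangle: "N (a + b) \<le> N a + N b"
  using N_ultra[of a b] N_ge_0[of a] N_ge_0[of b] by linarith

lemma N_diff: "\<bar>N a - N b\<bar> \<le> N (a - b)"
  using N_triangle[of "a - b" b] N_triangle[of "b - a" a] N_minus_commute[of a b] by auto

lemma N_inverse: "N (inverse a) = inverse (N a)"
proof (cases "a = 0")
  case False
  then have "N a * N (inverse a) = 1" using N_mult[of a "inverse a"] by simp
  then show ?thesis using inverse_unique by metis
qed simp

lemma null_add: "null X \<Longrightarrow> null Y \<Longrightarrow> null (\<lambda>n. X n + Y n)"
  unfolding null_def
  by (rule tendsto_sandwich[where f = "\<lambda>_. 0" and h = "\<lambda>n. N (X n) + N (Y n)"])
     (auto intro!: tendsto_eq_intros always_eventually N_triangle)

lemma null_minus: "null X \<Longrightarrow> null (\<lambda>n. - X n)"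
  by (simp add: null_def)

lemma null_mult_bounded:
  assumes "null X" "\<And>n. N (Y n) \<le> B"
  shows "null (\<lambda>n. Y n * X n)"
  unfolding null_def
proof (rule tendsto_sandwich[where f = "\<lambda>_. 0" and h = "\<lambda>n. B * N (X n)"])
  show "(\<lambda>n. B * N (X n)) \<longlonglongrightarrow> 0"
    using assms(1) unfolding null_def by (auto intro!: tendsto_eq_intros)
  show "\<forall>\<^sub>F n in sequentially. N (Y n * X n) \<le> B * N (X n)"
    using assms(2) by (auto simp: N_mult intro!: always_eventually mult_right_mono)
qed auto

lemma cau_const [simp]: "cau (\<lambda>_. c)"
  by (simp add: cau_def)

lemma cau_minus: "cau X \<Longrightarrow> cau (\<lambda>n. - X n)"
proof -
  have "N (- X m - - X n) = N (X m - X n)" for m n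
    using N_minus_commute[of "X m" "X n"] by simp
  then show "cau X \<Longrightarrow> cau (\<lambda>n. - X n)" unfolding cau_def by presburger
qed

lemma cau_add:
  assumes "cau X" "cau Y"
  shows "cau (\<lambda>n. X n + Y n)"
  unfolding cau_def
proof safe
  fix e :: real assume e: "e > 0"
  obtain k l where k: "\<forall>m\<ge>k. \<forall>n\<ge>k. N (X m - X n) < e" and l: "\<forall>m\<ge>l. \<forall>n\<ge>l. N (Y m - Y n) < e"
    using assms e unfolding cau_def by meson
  show "\<exists>k. \<forall>m\<ge>k. \<forall>n\<ge>k. N (X m + Y m - (X n + Y n)) < e"
  proof (intro exI[of _ "max k l"] allI impI)
    fix m n assume "m \<ge> max k l" "n \<ge> max k l"
    then have "max (N (X m - X n)) (N (Y m - Y n)) < e" using k l by simp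
    then show "N (X m + Y m - (X n + Y n)) < e"
      using N_ultra[of "X m - X n" "Y m - Y n"] unfolding add_diff_add by (rule order_le_less_trans[rotated])
  qed
qed

lemma cau_convergent:
  assumes "cau X"
  shows "convergent (\<lambda>n. N (X n))"
proof (rule Cauchy_convergent, rule metric_CauchyI)
  fix e :: real assume "e > 0"
  then obtain k where "\<forall>m\<ge>k. \<forall>n\<ge>k. N (X m - X n) < e" using assms unfolding cau_def by meson
  then show "\<exists>M. \<forall>m\<ge>M. \<forall>n\<ge>M. dist (N (X m)) (N (X n)) < e"
    using N_diff unfolding dist_real_def by (meson order_le_less_trans)
qed

lemma cau_lim: "cau X \<Longrightarrow> (\<lambda>n. N (X n)) \<longlonglongrightarrow> lim (\<lambda>n. N (X n))"
  using cau_convergent convergent_LIMSEQ_iff by blast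

lemma cau_bounded:
  assumes "cau X"
  obtains B where "B > 0" "\<And>n. N (X n) \<le> B"
proof -
  have "Bseq (\<lambda>n. N (X n))" using cau_convergent[OF assms] by (rule convergent_imp_Bseq)
  then show ?thesis using that by (elim BseqE) auto
qed

lemma cau_mult:
  assumes X: "cau X" and Y: "cau Y"
  shows "cau (\<lambda>n. X n * Y n)"
  unfolding cau_def
proof safe
  fix e :: real assume e: "e > 0"
  obtain A where A: "A > 0" "\<And>n. N (X n) \<le> A" using cau_bounded[OF X] by blast
  obtain B where B: "B > 0" "\<And>n. N (Y n) \<le> B" using cau_bounded[OF Y] by blast
  obtain k l where k: "\<forall>m\<ge>k. \<forall>n\<ge>k. N (X m - X n) < e / B"
    and l: "\<forall>m\<ge>l. \<forall>n\<ge>l. N (Y m - Y n) < e / A"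
    using X Y e A B unfolding cau_def by (meson divide_pos_pos)
  show "\<exists>k. \<forall>m\<ge>k. \<forall>n\<ge>k. N (X m * Y m - X n * Y n) < e"
  proof (intro exI[of _ "max k l"] allI impI)
    fix m n assume mn: "m \<ge> max k l" "n \<ge> max k l"
    have 1: "N (X m * (Y m - Y n)) < e"
    proof -
      have "N (X m * (Y m - Y n)) \<le> A * N (Y m - Y n)"
        unfolding N_mult by (intro mult_right_mono A) auto
      also have "\<dots> < A * (e / A)" using l mn A by (intro mult_strict_left_mono) auto
      finally show ?thesis using A by simp
    qed
    have 2: "N ((X m - X n) * Y n) < e"
    proof -
      have "N ((X m - X n) * Y n) \<le> N (X m - X n) * B"
        unfolding N_mult by (intro mult_left_mono B) auto
      also have "\<dots> < (e / B) * B" using k mn B by (intro mult_strict_right_mono) auto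
      finally show ?thesis using B by simp
    qed
    show "N (X m * Y m - X n * Y n) < e"
      using N_ultra[of "X m * (Y m - Y n)" "(X m - X n) * Y n"] 1 2 by (simp add: algebra_simps)
  qed
qed

lemma cau_not_null:
  assumes X: "cau X" and "\<not> null X"
  obtains b k where "b > 0" "\<And>n. n \<ge> k \<Longrightarrow> N (X n) > b"
proof -
  let ?L = "lim (\<lambda>n. N (X n))"
  have L: "(\<lambda>n. N (X n)) \<longlonglongrightarrow> ?L" by (rule cau_lim[OF X])
  then have "?L \<noteq> 0" using assms(2) unfolding null_def by metis
  moreover have "?L \<ge> 0" by (rule LIMSEQ_le_const[OF L]) auto
  ultimately have "?L > 0" by simp
  then have "\<forall>\<^sub>F n in sequentially. N (X n) > ?L / 2" using order_tendstoD(1)[OF L, of "?L / 2"] by simp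
  then show ?thesis using that[of "?L / 2"] \<open>?L > 0\<close> unfolding eventually_sequentially by auto
qed

lemma N_inverse_diff:
  assumes "N x > b" "N y > c" "b > 0" "c > 0"
  shows "N (inverse x - inverse y) \<le> inverse (b * c) * N (x - y)"
proof -
  have nz: "x \<noteq> 0" "y \<noteq> 0" using assms by auto
  then have "inverse x - inverse y = inverse (x * y) * (y - x)" by (simp add: field_simps)
  then have "N (inverse x - inverse y) = inverse (N x * N y) * N (x - y)"
    by (simp only: N_mult N_inverse N_minus_commute[of y x])
  also have "\<dots> \<le> inverse (b * c) * N (x - y)"
    using assms by (intro mult_right_mono le_imp_inverse_le mult_mono) auto
  finally show ?thesis .
qed

lemma cau_inverse:
  assumes X: "cau X" and nn: "\<not> null X"
  shows "cau (\<lambda>n. inverse (X n))"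
  unfolding cau_def
proof safe
  fix e :: real assume e: "e > 0"
  obtain b k where b: "b > 0" "\<And>n. n \<ge> k \<Longrightarrow> N (X n) > b" using cau_not_null[OF X nn] by blast
  obtain l where l: "\<forall>m\<ge>l. \<forall>n\<ge>l. N (X m - X n) < e * (b * b)"
    using X e b unfolding cau_def by (meson mult_pos_pos)
  show "\<exists>k. \<forall>m\<ge>k. \<forall>n\<ge>k. N (inverse (X m) - inverse (X n)) < e"
  proof (intro exI[of _ "max k l"] allI impI)
    fix m n assume mn: "m \<ge> max k l" "n \<ge> max k l"
    have "N (inverse (X m) - inverse (X n)) \<le> inverse (b * b) * N (X m - X n)"
      using mn b by (intro N_inverse_diff) auto
    also have "\<dots> < inverse (b * b) * (e * (b * b))"
      using mn b l by (intro mult_strict_left_mono) auto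
    also have "\<dots> = e" using b by (simp add: field_simps)
    finally show "N (inverse (X m) - inverse (X n)) < e" .
  qed
qed

lemma null_inverse_diff:
  assumes X: "cau X" "\<not> null X" and Y: "cau Y" "\<not> null Y" and XY: "null (\<lambda>n. X n - Y n)"
  shows "null (\<lambda>n. inverse (X n) - inverse (Y n))"
proof -
  obtain b k where b: "b > 0" "\<And>n. n \<ge> k \<Longrightarrow> N (X n) > b" using cau_not_null[OF X] by metis
  obtain c l where c: "c > 0" "\<And>n. n \<ge> l \<Longrightarrow> N (Y n) > c" using cau_not_null[OF Y] by metis
  show ?thesis unfolding null_def
  proof (rule tendsto_sandwich[where f = "\<lambda>_. 0" and h = "\<lambda>n. inverse (b * c) * N (X n - Y n)"])
    show "(\<lambda>n. inverse (b * c) * N (X n - Y n)) \<longlonglongrightarrow> 0"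
      using XY unfolding null_def by (auto intro!: tendsto_eq_intros)
    show "\<forall>\<^sub>F n in sequentially. N (inverse (X n) - inverse (Y n)) \<le> inverse (b * c) * N (X n - Y n)"
      using eventually_ge_at_top[of "max k l"]
    proof eventually_elim
      case (elim n)
      then show ?case using b c by (intro N_inverse_diff) auto
    qed
  qed auto
qed

lemma null_not_cong:
  assumes "null (\<lambda>n. X n - Y n)" "null X"
  shows "null Y"
  using null_add[OF assms(2) null_minus[OF assms(1)]] by simp

lemma null_diff_commute: "null (\<lambda>n. X n - Y n) \<Longrightarrow> null (\<lambda>n. Y n - X n)"
  by (simp add: null_def N_minus_commute)

definition crel :: "(nat \<Rightarrow> rat) \<Rightarrow> (nat \<Rightarrow> rat) \<Rightarrow> bool" where
  "crel X Y \<longleftrightarrow> cau X \<and> cau Y \<and> null (\<lambda>n. X n - Y n)"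

lemma crel_refl: "cau X \<Longrightarrow> crel X X"
  by (simp add: crel_def null_def)

lemma part_equivp_crel: "part_equivp crel"
proof (rule part_equivpI)
  show "\<exists>x. crel x x" using crel_refl[OF cau_const] by blast
  show "symp crel" by (auto simp: symp_def crel_def intro: null_diff_commute)
  show "transp crel"
    unfolding transp_def crel_def using null_add by fastforce
qed

lemma crel_add: "crel X X' \<Longrightarrow> crel Y Y' \<Longrightarrow> crel (\<lambda>n. X n + Y n) (\<lambda>n. X' n + Y' n)"
  using null_add[of "\<lambda>n. X n - X' n" "\<lambda>n. Y n - Y' n"]
  by (auto simp: crel_def cau_add algebra_simps)

lemma crel_minus: "crel X X' \<Longrightarrow> crel (\<lambda>n. - X n) (\<lambda>n. - X' n)"
  using null_diff_commute[of X X'] by (auto simp: crel_def cau_minus)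

lemma crel_mult:
  assumes "crel X X'" "crel Y Y'"
  shows "crel (\<lambda>n. X n * Y n) (\<lambda>n. X' n * Y' n)"
proof -
  have c: "cau X" "cau X'" "cau Y" "cau Y'" using assms by (auto simp: crel_def)
  obtain A where A: "\<And>n. N (X n) \<le> A" using cau_bounded[OF c(1)] by blast
  obtain B where B: "\<And>n. N (Y' n) \<le> B" using cau_bounded[OF c(4)] by blast
  have "null (\<lambda>n. X n * (Y n - Y' n))" "null (\<lambda>n. Y' n * (X n - X' n))"
    using assms A B by (auto simp: crel_def intro!: null_mult_bounded)
  from null_add[OF this] show ?thesis
    using c by (simp add: crel_def cau_mult algebra_simps)
qed

lemma crel_inverse:
  assumes "crel X X'"
  shows "crel (if null X then (\<lambda>n. 0) else (\<lambda>n. inverse (X n)))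
              (if null X' then (\<lambda>n. 0) else (\<lambda>n. inverse (X' n)))"
proof -
  have "null X \<longleftrightarrow> null X'"
    using assms null_not_cong null_diff_commute unfolding crel_def by blast
  then show ?thesis
    using assms by (auto simp: crel_def cau_inverse null_inverse_diff) (simp add: null_def)
qed

lemma crel_lim:
  assumes "crel X X'"
  shows "lim (\<lambda>n. N (X n)) = lim (\<lambda>n. N (X' n))"
proof -
  have c: "cau X" "cau X'" and n: "null (\<lambda>n. X n - X' n)" using assms by (auto simp: crel_def)
  have "(\<lambda>n. N (X n) - N (X' n)) \<longlonglongrightarrow> 0"
    by (rule Lim_null_comparison[where g = "\<lambda>n. N (X n - X' n)"])
       (use n in \<open>auto simp: null_def N_diff\<close>)
  moreover have "(\<lambda>n. N (X n) - N (X' n)) \<longlonglongrightarrow> lim (\<lambda>n. N (X n)) - lim (\<lambda>n. N (X' n))"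
    by (intro tendsto_diff cau_lim c)
  ultimately show ?thesis using LIMSEQ_unique by fastforce
qed

end


subsection \<open>Completion\<close>

interpretation padic: nonarch_abs "padic_abs CARD('p::prime_card)"
  by (rule nonarch_abs_padic_abs[OF prime_card])

typedef 'p padic_cauchy = "{X. nonarch_abs.cau (padic_abs CARD('p::prime_card)) X}"
  by (intro exI[of _ "\<lambda>_. 0"]) (simp add: padic.cau_const)

setup_lifting type_definition_padic_cauchy

lift_definition padic_rel :: "'p::prime_card padic_cauchy \<Rightarrow> 'p padic_cauchy \<Rightarrow> bool"
  is "nonarch_abs.crel (padic_abs CARD('p))" .

lemma equivp_padic_rel: "equivp padic_rel"
proof (rule equivpI)
  show "reflp padic_rel"
    by (rule reflpI, transfer) (simp add: padic.crel_refl)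
  show "symp padic_rel"
    by (rule sympI, transfer) (use padic.part_equivp_crel in \<open>blast dest: part_equivp_symp\<close>)
  show "transp padic_rel"
    by (rule transpI, transfer) (use padic.part_equivp_crel in \<open>blast dest: part_equivp_transp\<close>)
qed

quotient_type 'p padic = "'p::prime_card padic_cauchy" / padic_rel
  by (rule equivp_padic_rel)

instantiation padic_cauchy :: (prime_card) "{zero, one, plus, uminus, times, inverse}"
begin

lift_definition zero_padic_cauchy :: "'a padic_cauchy" is "\<lambda>_. 0" by simp
lift_definition one_padic_cauchy :: "'a padic_cauchy" is "\<lambda>_. 1" by simp
lift_definition plus_padic_cauchy :: "'a padic_cauchy \<Rightarrow> 'a padic_cauchy \<Rightarrow> 'a padic_cauchy"
  is "\<lambda>X Y n. X n + Y n" by (rule padic.cau_add)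
lift_definition uminus_padic_cauchy :: "'a padic_cauchy \<Rightarrow> 'a padic_cauchy"
  is "\<lambda>X n. - X n" by (rule padic.cau_minus)
lift_definition times_padic_cauchy :: "'a padic_cauchy \<Rightarrow> 'a padic_cauchy \<Rightarrow> 'a padic_cauchy"
  is "\<lambda>X Y n. X n * Y n" by (rule padic.cau_mult)
lift_definition inverse_padic_cauchy :: "'a padic_cauchy \<Rightarrow> 'a padic_cauchy"
  is "\<lambda>X. if nonarch_abs.null (padic_abs CARD('a)) X then (\<lambda>n. 0) else (\<lambda>n. inverse (X n))"
  by (simp add: padic.cau_inverse)
definition divide_padic_cauchy :: "'a padic_cauchy \<Rightarrow> 'a padic_cauchy \<Rightarrow> 'a padic_cauchy"
  where "divide_padic_cauchy x y = x * inverse y"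

instance ..

end

instantiation padic :: (prime_card) field
begin

lift_definition zero_padic :: "'a padic" is 0 .
lift_definition one_padic :: "'a padic" is 1 .
lift_definition plus_padic :: "'a padic \<Rightarrow> 'a padic \<Rightarrow> 'a padic" is "(+)"
  by transfer (rule padic.crel_add)
lift_definition uminus_padic :: "'a padic \<Rightarrow> 'a padic" is uminus
  by transfer (rule padic.crel_minus)
lift_definition times_padic :: "'a padic \<Rightarrow> 'a padic \<Rightarrow> 'a padic" is "(*)"
  by transfer (rule padic.crel_mult)
lift_definition inverse_padic :: "'a padic \<Rightarrow> 'a padic" is inverse
  by transfer (rule padic.crel_inverse)
definition minus_padic :: "'a padic \<Rightarrow> 'a padic \<Rightarrow> 'a padic"
  where "minus_padic x y = x + - y"
definition divide_padic :: "'a padic \<Rightarrow> 'a padic \<Rightarrow> 'a padic"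
  where "divide_padic x y = x * inverse y"

instance
proof
  fix a b c :: "'a padic"
  have eqI: "padic_rel X Y" if "X = Y" for X Y :: "'a padic_cauchy"
    using that equivp_padic_rel equivp_reflp by metis
  show "a + b + c = a + (b + c)"
    by transfer (rule eqI, transfer, simp add: add.assoc)
  show "a + b = b + a"
    by transfer (rule eqI, transfer, simp add: add.commute)
  show "0 + a = a"
    by transfer (rule eqI, transfer, simp)
  show "- a + a = 0"
    by transfer (rule eqI, transfer, simp)
  show "a - b = a + - b"
    by (rule minus_padic_def)
  show "a * b * c = a * (b * c)"
    by transfer (rule eqI, transfer, simp add: mult.assoc)
  show "a * b = b * a"
    by transfer (rule eqI, transfer, simp add: mult.commute)
  show "1 * a = a"
    by transfer (rule eqI, transfer, simp)
  show "(a + b) * c = a * c + b * c"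
    by transfer (rule eqI, transfer, simp add: distrib_right)
  show "(0::'a padic) \<noteq> 1"
    unfolding zero_padic_def one_padic_def padic.abs_eq_iff
    by transfer (simp add: padic.crel_def padic.null_def tendsto_const_iff)
  show "a div b = a * inverse b"
    by (rule divide_padic_def)
  show "inverse (0::'a padic) = 0"
    by transfer (rule eqI, transfer, simp add: padic.null_def)
  assume "a \<noteq> 0"
  then show "inverse a * a = 1"
  proof (transfer, transfer)
    fix X assume X: "nonarch_abs.cau (padic_abs CARD('a)) X" and nz: "\<not> nonarch_abs.crel (padic_abs CARD('a)) X (\<lambda>_. 0)"
    have nn: "\<not> nonarch_abs.null (padic_abs CARD('a)) X" using X nz by (simp add: padic.crel_def)
    obtain b k where b: "b > 0" "\<And>n. n \<ge> k \<Longrightarrow> padic_abs CARD('a) (X n) > b"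
      using padic.cau_not_null[OF X nn] by metis
    have "nonarch_abs.null (padic_abs CARD('a)) (\<lambda>n. inverse (X n) * X n - 1)"
      unfolding padic.null_def
    proof (rule tendsto_eventually)
      show "\<forall>\<^sub>F n in sequentially. padic_abs CARD('a) (inverse (X n) * X n - 1) = 0"
        using eventually_ge_at_top[of k]
      proof eventually_elim
        case (elim n)
        then have "X n \<noteq> 0" using b(1) b(2)[of n] by auto
        then show ?case by simp
      qed
    qed
    then show "nonarch_abs.crel (padic_abs CARD('a)) (\<lambda>n. (if nonarch_abs.null (padic_abs CARD('a)) X then \<lambda>n. 0 else (\<lambda>n. inverse (X n))) n * X n) (\<lambda>_. 1)"
      using X nn by (simp add: padic.crel_def padic.cau_mult padic.cau_inverse)
  qed
qed

end

subsection \<open>Norm and topology\<close>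

lift_definition padic_cauchy_norm :: "'p::prime_card padic_cauchy \<Rightarrow> real"
  is "\<lambda>X. lim (\<lambda>n. padic_abs CARD('p) (X n))" .

lift_definition padic_norm :: "'p::prime_card padic \<Rightarrow> real" is padic_cauchy_norm
  by transfer (rule padic.crel_lim)

instantiation padic :: (prime_card) metric_space
begin

definition dist_padic :: "'a padic \<Rightarrow> 'a padic \<Rightarrow> real"
  where "dist_padic x y = padic_norm (x - y)"

definition uniformity_padic :: "('a padic \<times> 'a padic) filter"
  where "uniformity_padic = (INF e\<in>{0 <..}. principal {(x, y). dist x y < e})"

definition open_padic :: "'a padic set \<Rightarrow> bool"
  where "open_padic U \<longleftrightarrow> (\<forall>x\<in>U. eventually (\<lambda>(x', y). x' = x \<longrightarrow> y \<in> U) uniformity)"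

lemma padic_norm_eq_0: "padic_norm (x::'a padic) = 0 \<longleftrightarrow> x = 0"
proof (transfer, transfer)
  fix X assume X: "nonarch_abs.cau (padic_abs CARD('a)) X"
  show "lim (\<lambda>n. padic_abs CARD('a) (X n)) = 0 \<longleftrightarrow> nonarch_abs.crel (padic_abs CARD('a)) X (\<lambda>_. 0)"
    using padic.cau_lim[OF X] X limI by (auto simp: padic.crel_def padic.null_def)
qed

lemma padic_norm_ultra: "padic_norm (x + y) \<le> max (padic_norm x) (padic_norm (y::'a padic))"
proof (transfer, transfer)
  fix X Y assume X: "nonarch_abs.cau (padic_abs CARD('a)) X" and Y: "nonarch_abs.cau (padic_abs CARD('a)) Y"
  show "lim (\<lambda>n. padic_abs CARD('a) (X n + Y n))
      \<le> max (lim (\<lambda>n. padic_abs CARD('a) (X n))) (lim (\<lambda>n. padic_abs CARD('a) (Y n)))"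
    by (rule LIMSEQ_le[OF padic.cau_lim[OF padic.cau_add[OF X Y]]
          tendsto_max[OF padic.cau_lim[OF X] padic.cau_lim[OF Y]]])
       (use padic.N_ultra in blast)
qed

lemma padic_norm_ge_0: "padic_norm (x::'a padic) \<ge> 0"
proof (transfer, transfer)
  fix X assume X: "nonarch_abs.cau (padic_abs CARD('a)) X"
  show "0 \<le> lim (\<lambda>n. padic_abs CARD('a) (X n))"
    by (rule LIMSEQ_le_const[OF padic.cau_lim[OF X]]) auto
qed

lemma padic_norm_minus: "padic_norm (- x) = padic_norm (x::'a padic)"
  by (transfer, transfer) simp

instance
proof
  fix x y z :: "'a padic"
  show "dist x y = 0 \<longleftrightarrow> x = y"
    by (simp add: dist_padic_def padic_norm_eq_0)
  have "padic_norm (x - y) \<le> max (padic_norm (x - z)) (padic_norm (y - z))"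
    using padic_norm_ultra[of "x - z" "- (y - z)"] unfolding padic_norm_minus by simp
  then show "dist x y \<le> dist x z + dist y z"
    using padic_norm_ge_0[of "x - z"] padic_norm_ge_0[of "y - z"] by (simp add: dist_padic_def)
qed (rule uniformity_padic_def open_padic_def)+

end

text \<open>
  The following facts identify \<open>'p padic\<close> as the field of \<open>p\<close>-adic numbers: it is a complete
  field with a multiplicative ultrametric norm extending the \<open>p\<close>-adic absolute value, and the
  rationals are dense in it.
\<close>

lemma padic_norm_mult: "padic_norm (x * y) = padic_norm x * padic_norm (y::'p::prime_card padic)"
proof (transfer, transfer)
  fix X Y assume X: "nonarch_abs.cau (padic_abs CARD('p)) X" and Y: "nonarch_abs.cau (padic_abs CARD('p)) Y"
  show "lim (\<lambda>n. padic_abs CARD('p) (X n * Y n))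
      = lim (\<lambda>n. padic_abs CARD('p) (X n)) * lim (\<lambda>n. padic_abs CARD('p) (Y n))"
    using tendsto_mult[OF padic.cau_lim[OF X] padic.cau_lim[OF Y]]
    by (simp add: padic.N_mult limI)
qed

lift_definition padic_cauchy_const :: "rat \<Rightarrow> 'p::prime_card padic_cauchy" is "\<lambda>r _. r" by simp
lift_definition padic_emb :: "rat \<Rightarrow> 'p::prime_card padic" is padic_cauchy_const .

lemma padic_emb_add: "padic_emb (a + b) = padic_emb a + padic_emb b"
  by transfer (transfer, simp add: padic.crel_refl)
lemma padic_emb_mult: "padic_emb (a * b) = padic_emb a * padic_emb b"
  by transfer (transfer, simp add: padic.crel_refl)
lemma padic_emb_0: "padic_emb 0 = 0"
  by transfer (transfer, simp add: padic.crel_refl)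
lemma padic_emb_1: "padic_emb 1 = 1"
  by transfer (transfer, simp add: padic.crel_refl)
lemma padic_emb_minus: "padic_emb (- a) = - padic_emb a"
  by transfer (transfer, simp add: padic.crel_refl)
lemma padic_norm_emb: "padic_norm (padic_emb r :: 'p::prime_card padic) = padic_abs CARD('p) r"
  by transfer (transfer, simp)
lemma padic_emb_of_nat: "padic_emb (of_nat n) = of_nat n"
  by (induction n) (simp_all add: padic_emb_0 padic_emb_1 padic_emb_add)
lemma padic_emb_of_int: "padic_emb (of_int n) = of_int n"
  by (cases n rule: int_diff_cases)
     (simp add: padic_emb_of_nat padic_emb_add padic_emb_minus diff_conv_add_uminus del: add_uminus_conv_diff)

instance padic :: (prime_card) field_char_0
proof
  show "inj (of_nat :: nat \<Rightarrow> 'a padic)"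
  proof (rule injI)
    fix m n :: nat assume "of_nat m = (of_nat n :: 'a padic)"
    then have "padic_emb (of_nat m - of_nat n) = (0 :: 'a padic)"
      by (simp add: padic_emb_of_nat padic_emb_add padic_emb_minus diff_conv_add_uminus del: add_uminus_conv_diff)
    then have "padic_abs CARD('a) (of_nat m - of_nat n) = 0"
      using padic_norm_emb[where 'p = 'a] padic_norm_eq_0 by metis
    then show "m = n" by simp
  qed
qed

lemma padic_emb_of_rat: "padic_emb r = (of_rat r :: 'p::prime_card padic)"
proof -
  obtain a b where ab: "quotient_of r = (a, b)" by force
  have b: "b > 0" and r: "r = of_int a / of_int b"
    using quotient_of_denom_pos[OF ab] quotient_of_div[OF ab] by auto
  have "padic_emb r * of_int b = (of_int a :: 'p padic)"
    using b by (simp add: r flip: padic_emb_of_int padic_emb_mult)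
  then show ?thesis using b by (simp add: r of_rat_divide field_simps)
qed

lemma padic_norm_of_rat: "padic_norm (of_rat r :: 'p::prime_card padic) = padic_abs CARD('p) r"
  by (simp flip: padic_emb_of_rat add: padic_norm_emb)

lemma padic_seq_approx:
  assumes X: "nonarch_abs.cau (padic_abs CARD('p)) X" and e: "e > 0"
  shows "\<exists>k. \<forall>n\<ge>k. padic_norm (abs_padic (Abs_padic_cauchy X) - of_rat (X n) :: 'p::prime_card padic) < e"
proof -
  obtain k where k: "\<forall>m\<ge>k. \<forall>n\<ge>k. padic_abs CARD('p) (X m - X n) < e / 2"
    using X e unfolding padic.cau_def by (meson half_gt_zero)
  have "padic_norm (abs_padic (Abs_padic_cauchy X) - of_rat (X n) :: 'p padic) < e" if n: "n \<ge> k" for n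
  proof -
    have c: "nonarch_abs.cau (padic_abs CARD('p)) (\<lambda>m. X m + - X n)" by (intro padic.cau_add X padic.cau_const)
    have "padic_norm (abs_padic (Abs_padic_cauchy X) - of_rat (X n) :: 'p padic)
        = lim (\<lambda>m. padic_abs CARD('p) (X m + - X n))"
      using X by (simp add: diff_conv_add_uminus padic_emb_of_rat[symmetric] padic_emb.abs_eq uminus_padic.abs_eq
        plus_padic.abs_eq padic_norm.abs_eq padic_cauchy_norm.rep_eq plus_padic_cauchy.rep_eq
        uminus_padic_cauchy.rep_eq padic_cauchy_const.rep_eq Abs_padic_cauchy_inverse del: add_uminus_conv_diff)
    also have "\<dots> \<le> e / 2"
      by (rule LIMSEQ_le_const2[OF padic.cau_lim[OF c]])
         (use k n in \<open>auto intro!: exI[of _ k] less_imp_le\<close>)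
    finally show ?thesis using e by simp
  qed
  then show ?thesis by blast
qed

lemma padic_rat_dense:
  fixes x :: "'p::prime_card padic"
  assumes "e > 0"
  shows "\<exists>r. dist x (of_rat r) < e"
proof -
  obtain Y where Y: "x = abs_padic Y" by (induction x rule: padic.abs_induct) blast
  obtain X where X: "nonarch_abs.cau (padic_abs CARD('p)) X" "Y = Abs_padic_cauchy X"
    using Abs_padic_cauchy_cases[of Y] by auto
  show ?thesis using padic_seq_approx[OF X(1) assms] unfolding Y X(2) dist_padic_def by blast
qed

instance padic :: (prime_card) complete_space
proof
  fix Q :: "nat \<Rightarrow> 'a padic" assume Q: "Cauchy Q"
  have "\<forall>n. \<exists>r. dist (Q n) (of_rat r) < inverse (real (Suc n))"
    by (intro allI padic_rat_dense) simp
  then obtain r where r: "\<And>n. dist (Q n) (of_rat (r n)) < inverse (real (Suc n))" by metis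
  have small: "\<exists>k. \<forall>n\<ge>k. dist (Q n) (of_rat (r n)) < e" if e: "e > 0" for e
  proof -
    obtain k where k: "inverse (real (Suc k)) < e" using reals_Archimedean[OF e] by blast
    have "dist (Q n) (of_rat (r n)) < e" if "n \<ge> k" for n
    proof -
      have "inverse (real (Suc n)) \<le> inverse (real (Suc k))" using that by simp
      then show ?thesis using r[of n] k by linarith
    qed
    then show ?thesis by blast
  qed
  have "\<exists>k. \<forall>m\<ge>k. \<forall>n\<ge>k. padic_abs CARD('a) (r m - r n) < e" if e: "e > 0" for e
  proof -
    obtain k where k: "\<forall>n\<ge>k. dist (Q n) (of_rat (r n)) < e / 3" using small[of "e / 3"] e by auto
    obtain l where l: "\<forall>m\<ge>l. \<forall>n\<ge>l. dist (Q m) (Q n) < e / 3" using Q e unfolding Cauchy_def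
      by (meson divide_pos_pos zero_less_numeral)
    have "padic_abs CARD('a) (r m - r n) < e" if mn: "m \<ge> max k l" "n \<ge> max k l" for m n
    proof -
      have "dist (of_rat (r m) :: 'a padic) (of_rat (r n)) < e"
        using k[rule_format, of m] k[rule_format, of n] l[rule_format, of m n] mn
          dist_triangle[of "of_rat (r m)" "of_rat (r n)" "Q m"]
          dist_triangle[of "Q m" "of_rat (r n)" "Q n"]
        by (simp add: dist_commute)
      then show ?thesis by (simp add: dist_padic_def padic_norm_of_rat flip: of_rat_diff)
    qed
    then show ?thesis by blast
  qed
  then have c: "nonarch_abs.cau (padic_abs CARD('a)) r" unfolding padic.cau_def by blast
  define L :: "'a padic" where "L = abs_padic (Abs_padic_cauchy r)"
  have "Q \<longlonglongrightarrow> L"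
  proof (rule metric_LIMSEQ_I)
    fix e :: real assume e: "e > 0"
    obtain k where k: "\<forall>n\<ge>k. dist (Q n) (of_rat (r n)) < e / 2" using small[of "e / 2"] e by auto
    obtain l where l: "\<forall>n\<ge>l. dist L (of_rat (r n)) < e / 2"
      using padic_seq_approx[OF c, of "e / 2"] e unfolding L_def dist_padic_def by auto
    show "\<exists>no. \<forall>n\<ge>no. dist (Q n) L < e"
    proof (intro exI[of _ "max k l"] allI impI)
      fix n assume "n \<ge> max k l"
      then show "dist (Q n) L < e"
        using k[rule_format, of n] l[rule_format, of n] dist_triangle2[of "Q n" L "of_rat (r n)"] by simp
    qed
  qed
  then show "convergent Q" by (rule convergentI)
qed

definition padic_E :: "'p::prime_card padic set" where
  "padic_E = {a. padic_norm (a - 1) < real CARD('p) powr (- 1 / (real CARD('p) - 1))}"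


section \<open>Cayley trees\<close>

text \<open>
  A graph is given by a vertex set \<open>V\<close> and an adjacency relation \<open>E\<close>; only the restriction
  of \<open>E\<close> to \<open>V\<close> matters.
\<close>

definition walk :: "'v set \<Rightarrow> ('v \<Rightarrow> 'v \<Rightarrow> bool) \<Rightarrow> 'v list \<Rightarrow> bool" where
  "walk V E xs \<longleftrightarrow> xs \<noteq> [] \<and> set xs \<subseteq> V \<and> successively E xs"

definition cycle_in :: "'v set \<Rightarrow> ('v \<Rightarrow> 'v \<Rightarrow> bool) \<Rightarrow> 'v list \<Rightarrow> bool" where
  "cycle_in V E xs \<longleftrightarrow> walk V E xs \<and> distinct xs \<and> length xs \<ge> 3 \<and> E (last xs) (hd xs)"

definition is_tree :: "'v set \<Rightarrow> ('v \<Rightarrow> 'v \<Rightarrow> bool) \<Rightarrow> bool" where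
  "is_tree V E \<longleftrightarrow>
     (\<forall>x\<in>V. \<not> E x x) \<and> (\<forall>x\<in>V. \<forall>y\<in>V. E x y \<longrightarrow> E y x) \<and>
     (\<forall>x\<in>V. \<forall>y\<in>V. \<exists>xs. walk V E xs \<and> hd xs = x \<and> last xs = y) \<and>
     (\<nexists>xs. cycle_in V E xs)"

definition cayley_tree :: "'v set \<Rightarrow> ('v \<Rightarrow> 'v \<Rightarrow> bool) \<Rightarrow> nat \<Rightarrow> bool" where
  "cayley_tree V E k \<longleftrightarrow>
     is_tree V E \<and> infinite V \<and> (\<forall>x\<in>V. card {y \<in> V. E x y} = k + 1)"

definition graph_dist :: "'v set \<Rightarrow> ('v \<Rightarrow> 'v \<Rightarrow> bool) \<Rightarrow> 'v \<Rightarrow> 'v \<Rightarrow> nat" where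
  "graph_dist V E x y =
     (LEAST n. \<exists>xs. walk V E xs \<and> hd xs = x \<and> last xs = y \<and> length xs = Suc n)"

definition level :: "'v set \<Rightarrow> ('v \<Rightarrow> 'v \<Rightarrow> bool) \<Rightarrow> 'v \<Rightarrow> nat \<Rightarrow> 'v set" where
  "level V E x0 n = {x \<in> V. graph_dist V E x x0 = n}"

definition volume :: "'v set \<Rightarrow> ('v \<Rightarrow> 'v \<Rightarrow> bool) \<Rightarrow> 'v \<Rightarrow> nat \<Rightarrow> 'v set" where
  "volume V E x0 n = (\<Union>m\<in>{0..n}. level V E x0 m)"

definition succs :: "'v set \<Rightarrow> ('v \<Rightarrow> 'v \<Rightarrow> bool) \<Rightarrow> 'v \<Rightarrow> 'v \<Rightarrow> 'v set" where
  "succs V E x0 x =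
     {y \<in> level V E x0 (Suc (graph_dist V E x x0)). graph_dist V E x y = 1}"


section \<open>The hard-core model with spin values in the natural numbers\<close>

definition admissible_configs :: "('v \<Rightarrow> 'v \<Rightarrow> bool) \<Rightarrow> 'v set \<Rightarrow> ('v \<Rightarrow> nat) set" where
  "admissible_configs E A =
     {\<sigma> \<in> A \<rightarrow>\<^sub>E UNIV. \<forall>x\<in>A. \<forall>y\<in>A. E x y \<longrightarrow> \<sigma> x * \<sigma> y = 0}"

text \<open>
  Throughout, \<open>lam i\<close> stands for the product \<open>\<lambda>\<^sub>i \<nu>(i)\<close> of the activity and the reference
  probability measure, and \<open>z i x\<close> for the boundary value of spin \<open>i\<close> at the vertex \<open>x\<close>.
\<close>

definition gibbs_weight ::
  "'v set \<Rightarrow> ('v \<Rightarrow> 'v \<Rightarrow> bool) \<Rightarrow> 'v \<Rightarrow> (nat \<Rightarrow> 'p::prime_card padic) \<Rightarrow> (nat \<Rightarrow> 'v \<Rightarrow> 'p padic)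
     \<Rightarrow> nat \<Rightarrow> ('v \<Rightarrow> nat) \<Rightarrow> 'p padic" where
  "gibbs_weight V E x0 lam z n \<sigma> =
     (\<Prod>x\<in>volume V E x0 n. lam (\<sigma> x)) * (\<Prod>x\<in>level V E x0 n. z (\<sigma> x) x)"

text \<open>
  The normalizing sum ranges over infinitely many configurations.  Its convergence is not required
  below (\<open>infsum\<close> is 0 if there is no sum), so fewer conditions are imposed on a Gibbs
  distribution and its nonexistence becomes the stronger claim.
\<close>

definition partition_sum ::
  "'v set \<Rightarrow> ('v \<Rightarrow> 'v \<Rightarrow> bool) \<Rightarrow> 'v \<Rightarrow> (nat \<Rightarrow> 'p::prime_card padic) \<Rightarrow> (nat \<Rightarrow> 'v \<Rightarrow> 'p padic)
     \<Rightarrow> nat \<Rightarrow> 'p padic" where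
  "partition_sum V E x0 lam z n =
     (\<Sum>\<^sub>\<infinity>\<sigma>\<in>admissible_configs E (volume V E x0 n). gibbs_weight V E x0 lam z n \<sigma>)"

text \<open>
  Compatibility of the finite-volume distributions, in the form of the functional equation for
  the boundary function.
\<close>

definition compatible ::
  "'v set \<Rightarrow> ('v \<Rightarrow> 'v \<Rightarrow> bool) \<Rightarrow> 'v \<Rightarrow> (nat \<Rightarrow> 'p::prime_card padic) \<Rightarrow> (nat \<Rightarrow> 'v \<Rightarrow> 'p padic)
     \<Rightarrow> bool" where
  "compatible V E x0 lam z \<longleftrightarrow>
     summable lam \<and>
     (\<forall>y\<in>V. summable (\<lambda>j. z j y) \<and> 1 + (\<Sum>j. z j y) \<noteq> 0) \<and>
     (\<forall>x\<in>V - {x0}. \<forall>i. z i x = lam i * (\<Prod>y\<in>succs V E x0 x. 1 / (1 + (\<Sum>j. z j y))))"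

definition generalized_gibbs_distribution ::
  "'v set \<Rightarrow> ('v \<Rightarrow> 'v \<Rightarrow> bool) \<Rightarrow> 'v \<Rightarrow> (nat \<Rightarrow> 'p::prime_card padic) \<Rightarrow> (nat \<Rightarrow> 'v \<Rightarrow> 'p padic)
     \<Rightarrow> (nat \<Rightarrow> ('v \<Rightarrow> nat) \<Rightarrow> 'p padic) \<Rightarrow> bool" where
  "generalized_gibbs_distribution V E x0 lam z \<mu> \<longleftrightarrow>
     compatible V E x0 lam z \<and>
     (\<forall>n. \<forall>\<sigma>\<in>admissible_configs E (volume V E x0 n).
        \<mu> n \<sigma> = 1 / partition_sum V E x0 lam z n * gibbs_weight V E x0 lam z n \<sigma>)"

definition padic_gibbs_distribution ::
  "'v set \<Rightarrow> ('v \<Rightarrow> 'v \<Rightarrow> bool) \<Rightarrow> 'v \<Rightarrow> (nat \<Rightarrow> ('v \<Rightarrow> nat) \<Rightarrow> 'p::prime_card padic) \<Rightarrow> bool" where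
  "padic_gibbs_distribution V E x0 \<mu> \<longleftrightarrow>
     (\<exists>lam z. (\<forall>i. lam i \<in> padic_E) \<and> (\<forall>i. \<forall>x\<in>V. z i x \<in> padic_E) \<and>
        generalized_gibbs_distribution V E x0 lam z \<mu>)"

end

(* A p-adic series converges only if its terms tend to 0, whereas every element of E_p has
   absolute value 1; so already the required convergence of the series of the parameters
   lambda_i is impossible. *)

theory Submission
  imports Defs
begin

lemma padic_norm_1: "padic_norm (1 :: 'p::prime_card padic) = 1"
proof -
  have "padic_norm (1 :: 'p padic) * padic_norm (1 :: 'p padic) = padic_norm (1 :: 'p padic)"
    by (simp flip: padic_norm_mult)
  then show ?thesis
    by (simp add: padic_norm_eq_0)
qed

text \<open>The radius of \<open>padic_E\<close> is a power of \<open>CARD('p)\<close> > 1 with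
  negative exponent, hence below 1.\<close>

lemma padic_norm_diff_1_less:
  fixes a :: "'p::prime_card padic"
  assumes "a \<in> padic_E"
  shows "padic_norm (a - 1) < 1"
proof -
  have "real CARD('p) > 1"
    using prime_gt_1_nat[OF prime_card[where 'a = 'p]] by simp
  then have "real CARD('p) powr (- 1 / (real CARD('p) - 1)) < 1"
    by (simp add: powr_less_one)
  with assms show ?thesis
    by (simp add: padic_E_def)
qed

text \<open>Write 1 = a - (a - 1): the ultrametric inequality bounds 1 by the larger of the norms of
  a and a - 1, and the latter is below 1.\<close>

lemma padic_norm_padic_E_ge_1:
  fixes a :: "'p::prime_card padic"
  assumes "a \<in> padic_E"
  shows "padic_norm a \<ge> 1"
  using padic_norm_ultra[of a "- (a - 1)"] padic_norm_diff_1_less[OF assms]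
  by (simp only: padic_norm_minus) (simp add: padic_norm_1)

lemma summable_padic_norm_less:
  fixes f :: "nat \<Rightarrow> 'p::prime_card padic"
  assumes "summable f" and "e > 0"
  shows "\<exists>n. padic_norm (f n) < e"
proof -
  have "Cauchy (\<lambda>n. \<Sum>i<n. f i)"
    using assms(1) by (auto simp: summable_def sums_def intro: LIMSEQ_imp_Cauchy)
  then obtain N where "\<forall>m\<ge>N. \<forall>n\<ge>N. dist (\<Sum>i<m. f i) (\<Sum>i<n. f i) < e"
    using assms(2) unfolding Cauchy_def by blast
  \<comment> \<open>Consecutive partial sums differ by exactly the term \<open>f N\<close>, which
    serves as the witness.\<close>
  then have "dist (\<Sum>i<Suc N. f i) (\<Sum>i<N. f i) < e"
    using le_SucI by blast
  then show ?thesis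
    by (auto simp: dist_padic_def)
qed

lemma not_summable_padic_E:
  fixes f :: "nat \<Rightarrow> 'p::prime_card padic"
  assumes "\<And>i. f i \<in> padic_E"
  shows "\<not> summable f"
  \<comment> \<open>Summability with threshold 1 would give a term of norm below 1.\<close>
  using summable_padic_norm_less[of f 1] padic_norm_padic_E_ge_1[OF assms] by (auto simp: not_less[symmetric])

theorem theorem9:
  fixes V :: "'v set" and E :: "'v \<Rightarrow> 'v \<Rightarrow> bool" and x0 :: 'v and k :: nat
  assumes "k \<ge> 1" and "cayley_tree V E k" and "x0 \<in> V"
  shows "\<not> (\<exists>\<mu> :: nat \<Rightarrow> ('v \<Rightarrow> nat) \<Rightarrow> 'p::prime_card padic. padic_gibbs_distribution V E x0 \<mu>)"
  unfolding padic_gibbs_distribution_def generalized_gibbs_distribution_def compatible_def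
  using not_summable_padic_E by blast

end
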